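(* Consider the symmetric $N$-partite W state $|W_N\rangle=\frac{1}{\sqrt N}(|10\cdots0\rangle+|01\cdots0\rangle+\cdots+|00\cdots1\rangle)$ undergoing the local beam-splitter broadcasting protocol with reflectivity $R$. Its transmitted copy fidelity has the same structure as that of the GHZ state $|\mathrm{GHZ}_N(\alpha)\rangle=\alpha|0\rangle^{\otimes N}+\sqrt{1-\alpha^2}\,|1\rangle^{\otimes N}$, with an identical denominator: $$\mathcal{F}_t^{(N)}(R)=\frac{Q_t^{(N)}(R)}{\left(R^2-R+\tfrac13\right)^N},$$ where the numerator $Q_t^{(N)}$ involves a weighted sum over the $N$ single-excitation basis states with beam-splitter redistribution coefficients. The exponential decay $\mathcal{F}_t^{(N)}\sim[c_W(R)]^N$ satisfies $$c_W(R)\ge c_{\mathrm{GHZ}}(R)\qquad\text{for all } R\in[0,1/2].$$ Here $c_W(R)$ and $c_{\mathrm{GHZ}}(R)$ denote the per-party degradation factors of the transmitted copy fidelity for the W and GHZ inputs respectively, $c_{\mathrm{GHZ}}(R)$ being the factor in the corresponding decay $\mathcal{F}_{t}^{(N)}(R)\sim[c_{\mathrm{GHZ}}(R)]^N$, $N\to\infty$, for the GHZ input in the same protocol.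
   Context: Local beam-splitter broadcasting protocol with reflectivity $R$ (transmissivity $1-R$). Let $|\Phi_N\rangle$ be an $N$-qubit unit vector on qubits $1,\dots,N$. For each $j=1,\dots,N$ take an ancillary pair of qubits $a_j,b_j$ in the state $|\chi_j\rangle_{a_jb_j}=\frac{1}{\sqrt2}(|01\rangle-|10\rangle)$ (symmetric broadcasting). The initial state on $3N$ qubits is $|\Psi_{\rm in}\rangle=|\Phi_N\rangle_{1\dots N}\otimes\bigotimes_{j=1}^N|\chi_j\rangle_{a_jb_j}$. Let $S_{j,a_j}$ be the swap operator exchanging qubits $j$ and $a_j$, and let $U_j=(1-R)\,\mathbf{1}-R\,S_{j,a_j}$ (the post-selected beam-splitter map of party $j$). The unnormalised output is $|\Psi_{\rm out}\rangle=\left(\prod_{j=1}^N U_j\right)|\Psi_{\rm in}\rangle$. Let $\rho_t$ be the partial trace of $|\Psi_{\rm out}\rangle\langle\Psi_{\rm out}|$ over all qubits $a_j,b_j$, so that $\rho_t$ acts on qubits $1,\dots,N$. The transmitted copy fidelity is $$\mathcal{F}_t^{(N)}=\frac{\langle\Phi_N|\rho_t|\Phi_N\rangle}{\langle\Psi_{\rm out}|\Psi_{\rm out}\rangle}.$$ *)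

theory Defs
  imports Complex_Main "HOL-Combinatorics.Transposition" "HOL-Library.Landau_Symbols"
begin

text \<open>
  Party \<open>j\<close> (parties are numbered from 0) holds the system qubit \<open>Sys j\<close> and the ancillas
  \<open>AncA j\<close>, \<open>AncB j\<close>.  A computational basis state of a finite register \<open>Q\<close> of qubits is
  represented by the set \<open>X \<subseteq> Q\<close> of those qubits that are in state \<open>|1\<rangle>\<close>, and a vector by its
  amplitudes; only the amplitudes at elements of \<open>Pow Q\<close> are relevant.
\<close>

datatype qubit = Sys nat | AncA nat | AncB nat

type_synonym ket = "qubit set \<Rightarrow> complex"

definition sys :: "nat \<Rightarrow> qubit set" where
  "sys N = Sys ` {..<N}"

definition anc :: "nat \<Rightarrow> qubit set" where
  "anc N = AncA ` {..<N} \<union> AncB ` {..<N}"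

definition braket :: "qubit set \<Rightarrow> ket \<Rightarrow> ket \<Rightarrow> complex" where
  "braket Q \<phi> \<psi> = (\<Sum>X\<in>Pow Q. cnj (\<phi> X) * \<psi> X)"

definition singlet :: "nat \<Rightarrow> ket" where
  "singlet j X =
     (if X = {AncB j} then 1 / sqrt 2 else if X = {AncA j} then - 1 / sqrt 2 else 0)"

text \<open>Restricting a basis state to a subregister is intersection with it.\<close>

definition psi_in :: "nat \<Rightarrow> ket \<Rightarrow> ket" where
  "psi_in N \<Phi> X = \<Phi> (X \<inter> sys N) * (\<Prod>j<N. singlet j (X \<inter> {AncA j, AncB j}))"

definition swap_op :: "qubit \<Rightarrow> qubit \<Rightarrow> ket \<Rightarrow> ket" where
  "swap_op p q \<psi> X = \<psi> (transpose p q ` X)"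

definition beam_splitter :: "real \<Rightarrow> nat \<Rightarrow> ket \<Rightarrow> ket" where
  "beam_splitter R j \<psi> X =
     complex_of_real (1 - R) * \<psi> X - complex_of_real R * swap_op (Sys j) (AncA j) \<psi> X"

text \<open>The maps of different parties commute, so their order in the product is immaterial.\<close>

definition psi_out :: "nat \<Rightarrow> real \<Rightarrow> ket \<Rightarrow> ket" where
  "psi_out N R \<Phi> = fold (beam_splitter R) [0..<N] (psi_in N \<Phi>)"

text \<open>
  \<open>rho_t N R \<Phi> X Y\<close> is the matrix element \<open>\<langle>X|\<rho>|Y\<rangle>\<close> of the partial trace over all ancillas; for
  \<open>X \<subseteq> sys N\<close> and \<open>A \<subseteq> anc N\<close> the set \<open>X \<union> A\<close> represents \<open>|X\<rangle> \<otimes> |A\<rangle>\<close>.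
\<close>

definition rho_t :: "nat \<Rightarrow> real \<Rightarrow> ket \<Rightarrow> qubit set \<Rightarrow> qubit set \<Rightarrow> complex" where
  "rho_t N R \<Phi> X Y =
     (\<Sum>A\<in>Pow (anc N). psi_out N R \<Phi> (X \<union> A) * cnj (psi_out N R \<Phi> (Y \<union> A)))"

text \<open>Both numerator and denominator are real, so \<open>Re\<close> only adjusts the type.\<close>

definition fidelity_t :: "nat \<Rightarrow> real \<Rightarrow> ket \<Rightarrow> real" where
  "fidelity_t N R \<Phi> =
     Re (braket (sys N) \<Phi> (\<lambda>X. \<Sum>Y\<in>Pow (sys N). rho_t N R \<Phi> X Y * \<Phi> Y)
       / braket (sys N \<union> anc N) (psi_out N R \<Phi>) (psi_out N R \<Phi>))"

definition single_excitations :: "nat \<Rightarrow> qubit set set" where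
  "single_excitations N = (\<lambda>j. {Sys j}) ` {..<N}"

definition W_state :: "nat \<Rightarrow> ket" where
  "W_state N X = (if X \<in> single_excitations N then 1 / sqrt (real N) else 0)"

definition GHZ_state :: "real \<Rightarrow> nat \<Rightarrow> ket" where
  "GHZ_state \<alpha> N X =
     (if X = {} then complex_of_real \<alpha> else 0)
     + (if X = sys N then complex_of_real (sqrt (1 - \<alpha>\<^sup>2)) else 0)"

text \<open>
  \<open>redistribution R s t t' s'\<close> is the coefficient of \<open>|s\<rangle>\<langle>s'|\<close> in the image of \<open>|t\<rangle>\<langle>t'|\<close> under
  the one-party map
  \<open>\<rho> \<mapsto> Tr\<^sub>a\<^sub>b (U (\<rho> \<otimes> |\<chi>\<rangle>\<langle>\<chi>|) U) = (1 - R) (1 - 2 R) \<rho> + (R\<^sup>2 / 2) (Tr \<rho>) 1\<close>.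
\<close>

definition redistribution :: "real \<Rightarrow> bool \<Rightarrow> bool \<Rightarrow> bool \<Rightarrow> bool \<Rightarrow> real" where
  "redistribution R s t t' s' =
     (1 - R) * (1 - 2 * R) * of_bool (s = t \<and> s' = t') + R\<^sup>2 / 2 * of_bool (t = t' \<and> s = s')"

text \<open>
  The numerator for a state \<open>\<Phi>\<close> supported on the basis states in \<open>B\<close>.  The factor \<open>1 / 3 ^ N\<close>
  normalises the denominator: the one-party map multiplies the trace by \<open>3 (R\<^sup>2 - R + 1/3)\<close>.
\<close>

definition numerator_t :: "qubit set set \<Rightarrow> nat \<Rightarrow> real \<Rightarrow> ket \<Rightarrow> complex" where
  "numerator_t B N R \<Phi> =
     1 / 3 ^ N *
     (\<Sum>X\<in>B. \<Sum>Y\<in>B. \<Sum>V\<in>B. \<Sum>Z\<in>B. cnj (\<Phi> X) * \<Phi> Y * \<Phi> V * cnj (\<Phi> Z) *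
        complex_of_real
          (\<Prod>j<N. redistribution R (Sys j \<in> X) (Sys j \<in> V) (Sys j \<in> Z) (Sys j \<in> Y)))"

text \<open>
  \<open>F N \<sim> c ^ N\<close> is read as asymptotic equivalence up to a positive prefactor that does not
  depend on \<open>N\<close>.
\<close>

definition decays_like :: "(nat \<Rightarrow> real) \<Rightarrow> real \<Rightarrow> bool" where
  "decays_like F c \<longleftrightarrow> c > 0 \<and> (\<exists>K>0. F \<sim>[at_top] (\<lambda>N. K * c ^ N))"

lemma decays_like_unique:
  assumes "decays_like F c" "decays_like F d"
  shows "c = d"
proof -
  have not_less: "\<not> c < d" if "decays_like F c" "decays_like F d" for c d
  proof
    assume "c < d"
    from that(1) obtain K where K: "K > 0" "F \<sim>[at_top] (\<lambda>N. K * c ^ N)" "c > 0"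
      by (auto simp: decays_like_def)
    from that(2) obtain L where L: "L > 0" "F \<sim>[at_top] (\<lambda>N. L * d ^ N)" "d > 0"
      by (auto simp: decays_like_def)
    have "(\<lambda>N. K * c ^ N) \<sim>[at_top] (\<lambda>N. L * d ^ N)"
      using K(2) L(2) asymp_equiv_sym asymp_equiv_trans by blast
    then have "(\<lambda>N. (K * c ^ N) / (L * d ^ N)) \<longlonglongrightarrow> 1"
      by (rule asymp_equivD_strong) (use K L in auto)
    moreover have "(\<lambda>N. (K / L) * (c / d) ^ N) \<longlonglongrightarrow> (K / L) * 0"
      using \<open>c < d\<close> K L by (intro tendsto_mult tendsto_const LIMSEQ_realpow_zero) auto
    ultimately have "(1::real) = (K / L) * 0"
      by (intro LIMSEQ_unique[where X = "\<lambda>N. (K / L) * (c / d) ^ N"])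
        (simp_all add: power_divide)
    then show False by simp
  qed
  from not_less[OF assms] not_less[OF assms(2,1)] show ?thesis by simp
qed

definition degradation_factor :: "(nat \<Rightarrow> real) \<Rightarrow> real" where
  "degradation_factor F = (THE c. decays_like F c)"

definition c_W :: "real \<Rightarrow> real" where
  "c_W R = degradation_factor (\<lambda>N. fidelity_t N R (W_state N))"

definition c_GHZ :: "real \<Rightarrow> real \<Rightarrow> real" where
  "c_GHZ \<alpha> R = degradation_factor (\<lambda>N. fidelity_t N R (GHZ_state \<alpha> N))"

end

theory Submission
  imports Defs "HOL-Library.Disjoint_Sets"
begin

text \<open>
  The amplitudes of the output state factorise over the parties, so tracing out the ancillas applies
  the one-party map \<open>\<rho> \<mapsto> p \<rho> + q (Tr \<rho>) 1\<close> to every system qubit, where \<open>p = (1 - R) (1 - 2 R)\<close> and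
  \<open>q = R\<^sup>2 / 2\<close>.  It multiplies the trace by \<open>p + 2 q = 3 (R\<^sup>2 - R + 1/3)\<close>, which gives the common
  denominator.  The numerators are sums of the terms that survive in the product over the parties:
  for W, \<open>N\<close> diagonal terms \<open>(p + q) ^ N\<close> and \<open>N (N - 1)\<close> terms each of the forms
  \<open>p\<^sup>2 (p + q) ^ (N - 2)\<close> and \<open>q\<^sup>2 (p + q) ^ (N - 2)\<close>, all divided by \<open>N\<^sup>2\<close>; for GHZ, a multiple of
  \<open>(p + q) ^ N\<close> plus a multiple of \<open>p ^ N + q ^ N\<close>.  On \<open>[0, 1/2]\<close> both \<open>p\<close> and \<open>q\<close> are nonnegative,
  so \<open>(p + q) ^ N\<close> dominates in both cases and the two factors both equal \<open>(p + q) / (p + 2 q)\<close>.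
\<close>

section \<open>Sums over basis states\<close>

lemma sum_Pow_Un_disjoint:
  assumes "A \<inter> B = {}"
  shows "(\<Sum>X\<in>Pow (A \<union> B). f X) = (\<Sum>X\<in>Pow A. \<Sum>Y\<in>Pow B. f (X \<union> Y))"
proof -
  have "(\<Sum>X\<in>Pow (A \<union> B). f X) = (\<Sum>(X, Y)\<in>Pow A \<times> Pow B. f (X \<union> Y))"
    by (rule sum.reindex_bij_witness[where i = "\<lambda>(X, Y). X \<union> Y" and j = "\<lambda>X. (X \<inter> A, X \<inter> B)"])
      (use assms in \<open>auto simp: Int_absorb2 simp flip: Int_Un_distrib\<close>)
  then show ?thesis by (simp add: sum.cartesian_product)
qed

text \<open>The distributive law in disguise: a subset of a disjoint union is an independent choice
  of a subset of each block. All traces below factorise over the parties by this lemma.\<close>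

lemma sum_Pow_UN_prod:
  fixes h :: "'i \<Rightarrow> 'a set \<Rightarrow> 'b :: comm_semiring_1"
  assumes "finite I" "disjoint_family_on S I"
  shows "(\<Sum>A\<in>Pow (\<Union>j\<in>I. S j). \<Prod>j\<in>I. h j (A \<inter> S j)) = (\<Prod>j\<in>I. \<Sum>B\<in>Pow (S j). h j B)"
  using assms
proof (induction I rule: finite_induct)
  case empty
  then show ?case by simp
next
  case (insert i I)
  have disj: "S i \<inter> S j = {}" if "j \<in> I" for j
    using insert.prems insert.hyps that by (auto simp: disjoint_family_on_def)
  have "(\<Sum>A\<in>Pow (\<Union>j\<in>insert i I. S j). \<Prod>j\<in>insert i I. h j (A \<inter> S j)) =
    (\<Sum>X\<in>Pow (S i). \<Sum>Y\<in>Pow (\<Union>j\<in>I. S j). \<Prod>j\<in>insert i I. h j ((X \<union> Y) \<inter> S j))"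
    unfolding UN_insert by (rule sum_Pow_Un_disjoint) (use disj in blast)
  also have "\<dots> = (\<Sum>X\<in>Pow (S i). \<Sum>Y\<in>Pow (\<Union>j\<in>I. S j). h i X * (\<Prod>j\<in>I. h j (Y \<inter> S j)))"
  proof (intro sum.cong refl)
    fix X Y assume X: "X \<in> Pow (S i)" and Y: "Y \<in> Pow (\<Union>j\<in>I. S j)"
    have "(X \<union> Y) \<inter> S i = X" using X Y disj by blast
    moreover have "(X \<union> Y) \<inter> S j = Y \<inter> S j" if "j \<in> I" for j
      using X disj[OF that] by blast
    ultimately show "(\<Prod>j\<in>insert i I. h j ((X \<union> Y) \<inter> S j)) = h i X * (\<Prod>j\<in>I. h j (Y \<inter> S j))"
      using insert.hyps by simp
  qed
  also have "\<dots> = (\<Sum>X\<in>Pow (S i). h i X) * (\<Prod>j\<in>I. \<Sum>B\<in>Pow (S j). h j B)"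
    using insert.prems insert.IH
    by (simp add: disjoint_family_on_def flip: sum_distrib_left sum_distrib_right)
  finally show ?case using insert.hyps by simp
qed

lemma sum_sys_prod:
  fixes h :: "nat \<Rightarrow> bool \<Rightarrow> 'b :: comm_semiring_1"
  shows "(\<Sum>X\<in>Pow (sys N). \<Prod>j<N. h j (Sys j \<in> X)) = (\<Prod>j<N. h j False + h j True)"
proof -
  have "(\<Sum>X\<in>Pow (\<Union>j<N. {Sys j}). \<Prod>j<N. h j (Sys j \<in> X \<inter> {Sys j})) =
    (\<Prod>j<N. \<Sum>B\<in>Pow {Sys j}. h j (Sys j \<in> B))"
    by (rule sum_Pow_UN_prod) (auto simp: disjoint_family_on_def)
  moreover have "(\<Union>j<N. {Sys j}) = sys N" by (auto simp: sys_def)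
  ultimately show ?thesis by (simp add: Pow_insert add.commute)
qed

lemma sum_anc_prod:
  fixes h :: "nat \<Rightarrow> bool \<Rightarrow> bool \<Rightarrow> 'b :: comm_semiring_1"
  shows "(\<Sum>A\<in>Pow (anc N). \<Prod>j<N. h j (AncA j \<in> A) (AncB j \<in> A)) =
    (\<Prod>j<N. \<Sum>a\<in>UNIV. \<Sum>b\<in>UNIV. h j a b)"
proof -
  have "(\<Sum>A\<in>Pow (\<Union>j<N. {AncA j, AncB j}).
      \<Prod>j<N. h j (AncA j \<in> A \<inter> {AncA j, AncB j}) (AncB j \<in> A \<inter> {AncA j, AncB j})) =
    (\<Prod>j<N. \<Sum>B\<in>Pow {AncA j, AncB j}. h j (AncA j \<in> B) (AncB j \<in> B))"
    by (rule sum_Pow_UN_prod) (auto simp: disjoint_family_on_def)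
  moreover have "(\<Union>j<N. {AncA j, AncB j}) = anc N" by (auto simp: anc_def)
  moreover have "(\<Sum>B\<in>Pow {AncA j, AncB j}. h j (AncA j \<in> B) (AncB j \<in> B)) =
      (\<Sum>a\<in>UNIV. \<Sum>b\<in>UNIV. h j a b)" for j
  proof -
    have "Pow {AncA j, AncB j} = {{}, {AncA j}, {AncB j}, {AncA j, AncB j}}"
      by (auto simp: Pow_insert)
    then show ?thesis by (simp add: UNIV_bool doubleton_eq_iff add_ac)
  qed
  ultimately show ?thesis by simp
qed

lemma finite_sys [simp]: "finite (sys N)"
  by (simp add: sys_def)

lemma finite_anc [simp]: "finite (anc N)"
  by (simp add: anc_def)

lemma sys_Int_anc: "sys N \<inter> anc N = {}"
  by (auto simp: sys_def anc_def)

lemma prod_of_bool: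
  "finite I \<Longrightarrow> (\<Prod>j\<in>I. of_bool (P j)) = (of_bool (\<forall>j\<in>I. P j) :: 'b :: comm_semiring_1)"
  by (induction I rule: finite_induct) auto

text \<open>Turns a product of per-qubit Kronecker deltas into a single delta between basis
  states.\<close>

lemma Pow_sys_eq_iff:
  assumes "X \<in> Pow (sys N)" "Y \<in> Pow (sys N)"
  shows "(\<forall>j\<in>{..<N}. (Sys j \<in> X) = (Sys j \<in> Y)) \<longleftrightarrow> X = Y"
  using assms by (fastforce simp: sys_def)

section \<open>The output state\<close>

definition singlet_amp :: "bool \<Rightarrow> bool \<Rightarrow> real" where
  "singlet_amp a b = (if a = b then 0 else if b then 1 / sqrt 2 else - 1 / sqrt 2)"

text \<open>
  The amplitude of \<open>|s\<rangle>|a b\<rangle>\<close> in the image of \<open>|t\<rangle> \<otimes> |\<chi>\<rangle>\<close> under the beam splitter of one party.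
\<close>

definition party_amp :: "real \<Rightarrow> bool \<Rightarrow> bool \<Rightarrow> bool \<Rightarrow> bool \<Rightarrow> real" where
  "party_amp R s a b t =
     (1 - R) * (of_bool (s = t) * singlet_amp a b) - R * (of_bool (a = t) * singlet_amp s b)"

text \<open>Kernel form of the input: the amplitude of \<open>\<Phi>\<close> is written as a sum
  against Kronecker deltas, so that every party contributes exactly one factor. It is the base case
  for \<open>fold_beam_splitter\<close>.\<close>

lemma psi_in_eq_sum:
  "psi_in N \<Phi> X = (\<Sum>V\<in>Pow (sys N). \<Phi> V * complex_of_real (\<Prod>j<N.
     of_bool ((Sys j \<in> X) = (Sys j \<in> V)) * singlet_amp (AncA j \<in> X) (AncB j \<in> X)))"
proof -
  have singlet: "singlet j (X \<inter> {AncA j, AncB j}) =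
      complex_of_real (singlet_amp (AncA j \<in> X) (AncB j \<in> X))" for j
  proof -
    have "X \<inter> {AncA j, AncB j} = {AncB j} \<longleftrightarrow> AncA j \<notin> X \<and> AncB j \<in> X"
      "X \<inter> {AncA j, AncB j} = {AncA j} \<longleftrightarrow> AncA j \<in> X \<and> AncB j \<notin> X"
      by auto
    then show ?thesis by (simp add: singlet_def singlet_amp_def)
  qed
  have "(\<Sum>V\<in>Pow (sys N). \<Phi> V * complex_of_real (\<Prod>j<N.
       of_bool ((Sys j \<in> X) = (Sys j \<in> V)) * singlet_amp (AncA j \<in> X) (AncB j \<in> X))) =
     (\<Sum>V\<in>Pow (sys N). if V = X \<inter> sys N then \<Phi> V *
       complex_of_real (\<Prod>j<N. singlet_amp (AncA j \<in> X) (AncB j \<in> X)) else 0)"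
  proof (intro sum.cong refl)
    fix V assume V: "V \<in> Pow (sys N)"
    have "(\<Prod>j<N. of_bool ((Sys j \<in> X) = (Sys j \<in> V)) :: real) = of_bool (V = X \<inter> sys N)"
    proof -
      have "(\<forall>j\<in>{..<N}. (Sys j \<in> X) = (Sys j \<in> V)) \<longleftrightarrow>
          (\<forall>j\<in>{..<N}. (Sys j \<in> V) = (Sys j \<in> X \<inter> sys N))"
        by (auto simp: sys_def)
      then show ?thesis using Pow_sys_eq_iff[OF V, of "X \<inter> sys N"] by (simp add: prod_of_bool)
    qed
    then show "\<Phi> V * complex_of_real (\<Prod>j<N.
         of_bool ((Sys j \<in> X) = (Sys j \<in> V)) * singlet_amp (AncA j \<in> X) (AncB j \<in> X)) =
       (if V = X \<inter> sys N then \<Phi> V *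
         complex_of_real (\<Prod>j<N. singlet_amp (AncA j \<in> X) (AncB j \<in> X)) else 0)"
      by (simp add: prod.distrib)
  qed
  also have "\<dots> = psi_in N \<Phi> X"
    by (simp add: psi_in_def singlet)
  finally show ?thesis by simp
qed

lemma mem_transpose_image:
  "q \<in> transpose a b ` X \<longleftrightarrow> transpose a b q \<in> X"
  by (metis image_iff transpose_involutory)

text \<open>Invariant after \<open>n\<close> beam splitters: parties below \<open>n\<close> carry
  the factor \<open>party_amp\<close>, the others still carry their input factor. \<open>X\<close>
  must vary in the induction because a swap evaluates the previous vector at another basis
  state.\<close>

lemma fold_beam_splitter:
  assumes "n \<le> N"
  shows "fold (beam_splitter R) [0..<n] (psi_in N \<Phi>) X =
    (\<Sum>V\<in>Pow (sys N). \<Phi> V * complex_of_real (\<Prod>j<N.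
       if j < n then party_amp R (Sys j \<in> X) (AncA j \<in> X) (AncB j \<in> X) (Sys j \<in> V)
       else of_bool ((Sys j \<in> X) = (Sys j \<in> V)) * singlet_amp (AncA j \<in> X) (AncB j \<in> X)))"
  using assms
proof (induction n arbitrary: X)
  case 0
  then show ?case by (simp add: psi_in_eq_sum)
next
  case (Suc n)
  \<comment> \<open>\<open>T\<close> is \<open>X\<close> with the bits of \<open>Sys n\<close> and
    \<open>AncA n\<close> exchanged, the basis state at which the swap reads its argument.\<close>
  define T where "T = transpose (Sys n) (AncA n) ` X"
  define g where "g m X V j =
      (if j < m then party_amp R (Sys j \<in> X) (AncA j \<in> X) (AncB j \<in> X) (Sys j \<in> V)
       else of_bool ((Sys j \<in> X) = (Sys j \<in> V)) * singlet_amp (AncA j \<in> X) (AncB j \<in> X))"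
    for m X V j
  have T: "Sys j \<in> T \<longleftrightarrow> (if j = n then AncA n \<in> X else Sys j \<in> X)"
    "AncA j \<in> T \<longleftrightarrow> (if j = n then Sys n \<in> X else AncA j \<in> X)"
    "AncB j \<in> T \<longleftrightarrow> AncB j \<in> X" for j
    by (auto simp: T_def mem_transpose_image transpose_def)
  \<comment> \<open>The factors of \<open>X\<close> and \<open>T\<close> agree away from party
    \<open>n\<close>, so \<open>rest\<close> can be pulled out; at \<open>n\<close> the claim is the
    definition of \<open>party_amp\<close>.\<close>
  have step: "(\<Prod>j<N. g (Suc n) X V j) = (1 - R) * (\<Prod>j<N. g n X V j) - R * (\<Prod>j<N. g n T V j)"
    for V
  proof -
    define rest where "rest = (\<Prod>j\<in>{..<N} - {n}. g n X V j)"
    have split: "(\<Prod>j<N. f j) = f n * (\<Prod>j\<in>{..<N} - {n}. f j)" for f :: "nat \<Rightarrow> real"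
      using Suc.prems by (intro prod.remove) auto
    have "(\<Prod>j\<in>{..<N} - {n}. g (Suc n) X V j) = rest" "(\<Prod>j\<in>{..<N} - {n}. g n T V j) = rest"
      unfolding rest_def by (intro prod.cong refl, simp add: g_def T less_Suc_eq)+
    then have "(\<Prod>j<N. g (Suc n) X V j) = g (Suc n) X V n * rest"
      "(\<Prod>j<N. g n X V j) = g n X V n * rest" "(\<Prod>j<N. g n T V j) = g n T V n * rest"
      by (simp_all add: split rest_def)
    moreover have "g (Suc n) X V n = (1 - R) * g n X V n - R * g n T V n"
      by (simp add: g_def T party_amp_def)
    ultimately show ?thesis by (simp add: algebra_simps)
  qed
  have IH: "fold (beam_splitter R) [0..<n] (psi_in N \<Phi>) Y =
      (\<Sum>V\<in>Pow (sys N). \<Phi> V * complex_of_real (\<Prod>j<N. g n Y V j))" for Y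
    using Suc by (simp add: g_def)
  have "fold (beam_splitter R) [0..<Suc n] (psi_in N \<Phi>) X =
      (\<Sum>V\<in>Pow (sys N). \<Phi> V * complex_of_real (\<Prod>j<N. g (Suc n) X V j))"
    unfolding step
    by (simp add: beam_splitter_def swap_op_def IH sum_distrib_left sum_subtractf sum.distrib algebra_simps
        flip: T_def)
  then show ?case by (simp add: g_def)
qed

lemma psi_out_eq_sum:
  "psi_out N R \<Phi> X = (\<Sum>V\<in>Pow (sys N). \<Phi> V * complex_of_real
     (\<Prod>j<N. party_amp R (Sys j \<in> X) (AncA j \<in> X) (AncB j \<in> X) (Sys j \<in> V)))"
  by (simp add: psi_out_def fold_beam_splitter)

text \<open>Tracing out the two ancillas of one party. The amplitudes are real, so no conjugate
  appears, and the sixteen values of the four bits leave polynomial identities in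
  \<open>R\<close>.\<close>

lemma sum_party_amp:
  "(\<Sum>a\<in>UNIV. \<Sum>b\<in>UNIV. party_amp R s a b t * party_amp R s' a b t') = redistribution R s t t' s'"
  by (cases s; cases s'; cases t; cases t')
    (simp_all add: UNIV_bool party_amp_def singlet_amp_def redistribution_def field_simps
      power2_eq_square)

text \<open>The reduced state is the image of the input projector under the \<open>N\<close>-fold
  tensor power of the one-party map: the amplitudes are products over parties, and so is the sum
  over the ancillas.\<close>

lemma rho_t_eq_sum:
  assumes "X \<in> Pow (sys N)" "Y \<in> Pow (sys N)"
  shows "rho_t N R \<Phi> X Y = (\<Sum>V\<in>Pow (sys N). \<Sum>Z\<in>Pow (sys N). \<Phi> V * cnj (\<Phi> Z) *
     complex_of_real (\<Prod>j<N. redistribution R (Sys j \<in> X) (Sys j \<in> V) (Sys j \<in> Z) (Sys j \<in> Y)))"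
proof -
  let ?P = "\<lambda>A X V. \<Prod>j<N. party_amp R (Sys j \<in> X) (AncA j \<in> A) (AncB j \<in> A) (Sys j \<in> V)"
  have psi: "psi_out N R \<Phi> (W \<union> A) = (\<Sum>V\<in>Pow (sys N). \<Phi> V * complex_of_real (?P A W V))"
    if "A \<in> Pow (anc N)" "W \<in> Pow (sys N)" for A W
  proof -
    have "Sys j \<notin> A" "AncA j \<notin> W" "AncB j \<notin> W" for j
      using that by (auto simp: sys_def anc_def)
    then show ?thesis by (simp add: psi_out_eq_sum)
  qed
  have trace: "(\<Sum>A\<in>Pow (anc N). ?P A X V * ?P A Y Z) =
      (\<Prod>j<N. redistribution R (Sys j \<in> X) (Sys j \<in> V) (Sys j \<in> Z) (Sys j \<in> Y))" for V Z
    unfolding prod.distrib[symmetric]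
    by (subst sum_anc_prod[where h = "\<lambda>j a b. party_amp R (Sys j \<in> X) a b (Sys j \<in> V) *
      party_amp R (Sys j \<in> Y) a b (Sys j \<in> Z)"]) (simp only: sum_party_amp)
  have "rho_t N R \<Phi> X Y = (\<Sum>A\<in>Pow (anc N). \<Sum>V\<in>Pow (sys N). \<Sum>Z\<in>Pow (sys N).
      \<Phi> V * cnj (\<Phi> Z) * complex_of_real (?P A X V * ?P A Y Z))"
    unfolding rho_t_def
  proof (intro sum.cong refl)
    fix A assume A: "A \<in> Pow (anc N)"
    show "psi_out N R \<Phi> (X \<union> A) * cnj (psi_out N R \<Phi> (Y \<union> A)) =
        (\<Sum>V\<in>Pow (sys N). \<Sum>Z\<in>Pow (sys N).
          \<Phi> V * cnj (\<Phi> Z) * complex_of_real (?P A X V * ?P A Y Z))"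
      unfolding psi[OF A assms(1)] psi[OF A assms(2)] cnj_sum sum_product
      by (simp add: mult_ac)
  qed
  also have "\<dots> = (\<Sum>V\<in>Pow (sys N). \<Sum>A\<in>Pow (anc N). \<Sum>Z\<in>Pow (sys N).
      \<Phi> V * cnj (\<Phi> Z) * complex_of_real (?P A X V * ?P A Y Z))"
    by (rule sum.swap)
  also have "\<dots> = (\<Sum>V\<in>Pow (sys N). \<Sum>Z\<in>Pow (sys N). \<Sum>A\<in>Pow (anc N).
      \<Phi> V * cnj (\<Phi> Z) * complex_of_real (?P A X V * ?P A Y Z))"
    by (intro sum.cong refl sum.swap)
  also have "\<dots> = (\<Sum>V\<in>Pow (sys N). \<Sum>Z\<in>Pow (sys N). \<Phi> V * cnj (\<Phi> Z) *
      complex_of_real (\<Sum>A\<in>Pow (anc N). ?P A X V * ?P A Y Z))"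
    by (simp only: sum_distrib_left of_real_sum)
  finally show ?thesis unfolding trace .
qed

section \<open>The fidelity\<close>

text \<open>The squared norm of the output is the trace of \<open>rho_t\<close>. Each party
  multiplies traces by a constant, and the remaining deltas collapse the double sum to the norm of
  \<open>\<Phi>\<close>.\<close>

lemma braket_psi_out:
  "braket (sys N \<union> anc N) (psi_out N R \<Phi>) (psi_out N R \<Phi>) =
     complex_of_real ((3 * (R\<^sup>2 - R + 1 / 3)) ^ N) * braket (sys N) \<Phi> \<Phi>"
proof -
  let ?r = "\<lambda>X V Z. \<Prod>j<N. redistribution R (Sys j \<in> X) (Sys j \<in> V) (Sys j \<in> Z) (Sys j \<in> X)"
  \<comment> \<open>The constant is \<open>p + 2 q\<close>: the coherent term contributes at one
    value of the output bit, the mixing term at both. Off-diagonal inputs have trace 0.\<close>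
  have tr: "redistribution R False t t' False + redistribution R True t t' True =
      3 * (R\<^sup>2 - R + 1 / 3) * of_bool (t = t')" for t t'
    by (cases t; cases t') (simp_all add: redistribution_def algebra_simps power2_eq_square)
  have r: "(\<Sum>X\<in>Pow (sys N). ?r X V Z) = (3 * (R\<^sup>2 - R + 1 / 3)) ^ N * of_bool (V = Z)"
    if "V \<in> Pow (sys N)" "Z \<in> Pow (sys N)" for V Z
    using that
    by (subst sum_sys_prod[where h = "\<lambda>j s. redistribution R s (Sys j \<in> V) (Sys j \<in> Z) s"])
      (simp only: tr prod.distrib prod_of_bool[OF finite_lessThan] Pow_sys_eq_iff prod_constant
        card_lessThan power_mult_distrib)
  have "braket (sys N \<union> anc N) (psi_out N R \<Phi>) (psi_out N R \<Phi>) = (\<Sum>X\<in>Pow (sys N). rho_t N R \<Phi> X X)"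
    by (simp add: braket_def sum_Pow_Un_disjoint[OF sys_Int_anc] rho_t_def mult_ac)
  also have "\<dots> = (\<Sum>X\<in>Pow (sys N). \<Sum>V\<in>Pow (sys N). \<Sum>Z\<in>Pow (sys N).
      \<Phi> V * cnj (\<Phi> Z) * complex_of_real (?r X V Z))"
    by (intro sum.cong refl rho_t_eq_sum)
  also have "\<dots> = (\<Sum>V\<in>Pow (sys N). \<Sum>X\<in>Pow (sys N). \<Sum>Z\<in>Pow (sys N).
      \<Phi> V * cnj (\<Phi> Z) * complex_of_real (?r X V Z))"
    by (rule sum.swap)
  also have "\<dots> = (\<Sum>V\<in>Pow (sys N). \<Sum>Z\<in>Pow (sys N). \<Sum>X\<in>Pow (sys N).
      \<Phi> V * cnj (\<Phi> Z) * complex_of_real (?r X V Z))"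
    by (intro sum.cong refl sum.swap)
  also have "\<dots> = (\<Sum>V\<in>Pow (sys N). \<Sum>Z\<in>Pow (sys N). \<Phi> V * cnj (\<Phi> Z) *
      complex_of_real (\<Sum>X\<in>Pow (sys N). ?r X V Z))"
    by (simp only: sum_distrib_left of_real_sum)
  also have "\<dots> = (\<Sum>V\<in>Pow (sys N). \<Sum>Z\<in>Pow (sys N).
      if V = Z then \<Phi> V * cnj (\<Phi> V) * complex_of_real ((3 * (R\<^sup>2 - R + 1 / 3)) ^ N) else 0)"
    by (intro sum.cong refl, subst r) auto
  also have "\<dots> = (\<Sum>V\<in>Pow (sys N). \<Phi> V * cnj (\<Phi> V) * complex_of_real ((3 * (R\<^sup>2 - R + 1 / 3)) ^ N))"
    by (intro sum.cong refl) (simp add: sum.delta)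
  finally show ?thesis
    by (simp only: braket_def sum_distrib_left sum_distrib_right mult_ac)
qed

text \<open>Conjugation exchanges \<open>X\<close> with \<open>Y\<close> and \<open>V\<close> with
  \<open>Z\<close>, a symmetry of \<open>redistribution\<close>. Hence the numerator is real and the
  \<open>Re\<close> in \<open>fidelity_t\<close> loses nothing.\<close>

lemma cnj_numerator_t: "cnj (numerator_t B N R \<Phi>) = numerator_t B N R \<Phi>"
proof -
  let ?r = "\<lambda>X V Z Y. complex_of_real
    (\<Prod>j<N. redistribution R (Sys j \<in> X) (Sys j \<in> V) (Sys j \<in> Z) (Sys j \<in> Y))"
  have r: "?r X V Z Y = ?r Y Z V X" for X V Z Y
    by (intro arg_cong[where f = complex_of_real] prod.cong refl) (auto simp: redistribution_def)
  have "cnj (\<Sum>X\<in>B. \<Sum>Y\<in>B. \<Sum>V\<in>B. \<Sum>Z\<in>B. cnj (\<Phi> X) * \<Phi> Y * \<Phi> V * cnj (\<Phi> Z) * ?r X V Z Y) =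
      (\<Sum>X\<in>B. \<Sum>Y\<in>B. \<Sum>V\<in>B. \<Sum>Z\<in>B. cnj (\<Phi> Y) * \<Phi> X * \<Phi> Z * cnj (\<Phi> V) * ?r X V Z Y)"
    by (simp only: cnj_sum complex_cnj_mult complex_cnj_cnj complex_cnj_complex_of_real mult_ac)
  also have "\<dots> = (\<Sum>Y\<in>B. \<Sum>X\<in>B. \<Sum>V\<in>B. \<Sum>Z\<in>B. cnj (\<Phi> Y) * \<Phi> X * \<Phi> Z * cnj (\<Phi> V) * ?r X V Z Y)"
    by (rule sum.swap)
  also have "\<dots> = (\<Sum>Y\<in>B. \<Sum>X\<in>B. \<Sum>Z\<in>B. \<Sum>V\<in>B. cnj (\<Phi> Y) * \<Phi> X * \<Phi> Z * cnj (\<Phi> V) * ?r X V Z Y)"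
    by (intro sum.cong refl sum.swap)
  also have "\<dots> = (\<Sum>Y\<in>B. \<Sum>X\<in>B. \<Sum>Z\<in>B. \<Sum>V\<in>B. cnj (\<Phi> Y) * \<Phi> X * \<Phi> Z * cnj (\<Phi> V) * ?r Y Z V X)"
    by (intro sum.cong refl arg_cong2[where f = "(*)"] r)
  finally show ?thesis
    unfolding numerator_t_def by simp
qed

text \<open>Only the support of \<open>\<Phi>\<close> contributes to the overlap, and the
  \<open>3 ^ N\<close> of the output norm cancels against the \<open>1 / 3 ^ N\<close> in
  \<open>numerator_t\<close>.\<close>

lemma fidelity_t_eq:
  assumes B: "B \<subseteq> Pow (sys N)" "\<And>X. X \<in> Pow (sys N) - B \<Longrightarrow> \<Phi> X = 0"
    and unit: "braket (sys N) \<Phi> \<Phi> = 1"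
  shows "complex_of_real (fidelity_t N R \<Phi>) =
    numerator_t B N R \<Phi> / complex_of_real ((R\<^sup>2 - R + 1 / 3) ^ N)"
proof -
  let ?r = "\<lambda>X V Z Y. complex_of_real
    (\<Prod>j<N. redistribution R (Sys j \<in> X) (Sys j \<in> V) (Sys j \<in> Z) (Sys j \<in> Y))"
  \<comment> \<open>Each of the four summation indices occurs in a factor \<open>\<Phi>\<close> or
    its conjugate, so all four sums shrink to \<open>B\<close>.\<close>
  have restrict: "(\<Sum>X\<in>Pow (sys N). f X) = (\<Sum>X\<in>B. f X)"
    if "\<And>X. \<Phi> X = 0 \<Longrightarrow> f X = 0" for f :: "qubit set \<Rightarrow> complex"
    using B that by (intro sum.mono_neutral_right) auto
  have "braket (sys N) \<Phi> (\<lambda>X. \<Sum>Y\<in>Pow (sys N). rho_t N R \<Phi> X Y * \<Phi> Y) =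
      (\<Sum>X\<in>Pow (sys N). \<Sum>Y\<in>Pow (sys N). \<Sum>V\<in>Pow (sys N). \<Sum>Z\<in>Pow (sys N).
        cnj (\<Phi> X) * \<Phi> Y * \<Phi> V * cnj (\<Phi> Z) * ?r X V Z Y)"
    unfolding braket_def
    by (intro sum.cong refl)
      (simp add: rho_t_eq_sum sum_distrib_left sum_distrib_right mult_ac del: of_real_prod)
  also have "\<dots> = (\<Sum>X\<in>B. \<Sum>Y\<in>B. \<Sum>V\<in>B. \<Sum>Z\<in>B. cnj (\<Phi> X) * \<Phi> Y * \<Phi> V * cnj (\<Phi> Z) * ?r X V Z Y)"
    by (simp add: restrict del: of_real_prod)
  also have "\<dots> = complex_of_real (3 ^ N) * numerator_t B N R \<Phi>"
    by (simp add: numerator_t_def)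
  finally have "fidelity_t N R \<Phi> =
      Re (numerator_t B N R \<Phi> / complex_of_real ((R\<^sup>2 - R + 1 / 3) ^ N))"
    unfolding fidelity_t_def braket_psi_out unit power_mult_distrib of_real_mult by simp
  moreover have "numerator_t B N R \<Phi> = complex_of_real (Re (numerator_t B N R \<Phi>))"
    using cnj_numerator_t[of B N R \<Phi>] by (simp add: complex_eq_iff)
  ultimately show ?thesis
    by (metis Re_complex_of_real of_real_divide)
qed

text \<open>The weights \<open>p\<close> and \<open>q\<close> of the one-party map get
  names.\<close>

definition coherent_coeff :: "real \<Rightarrow> real" where
  "coherent_coeff R = (1 - R) * (1 - 2 * R)"

definition mixing_coeff :: "real \<Rightarrow> real" where
  "mixing_coeff R = R\<^sup>2 / 2"

lemma redistribution_eq: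
  "redistribution R s t t' s' =
     coherent_coeff R * of_bool (s = t \<and> s' = t') + mixing_coeff R * of_bool (t = t' \<and> s = s')"
  by (simp add: redistribution_def coherent_coeff_def mixing_coeff_def)

section \<open>W states\<close>

text \<open>Two excitations on different parties leave \<open>N - 2\<close> parties on which all
  bits are 0 and the factor is constant.\<close>

lemma prod_two_exceptions:
  fixes f :: "nat \<Rightarrow> 'b :: comm_monoid_mult"
  assumes "a < N" "b < N" "a \<noteq> b" "\<And>j. j \<noteq> a \<Longrightarrow> j \<noteq> b \<Longrightarrow> f j = c"
  shows "(\<Prod>j<N. f j) = f a * f b * c ^ (N - 2)"
proof -
  have "(\<Prod>j<N. f j) = f a * (f b * (\<Prod>j\<in>{..<N} - {a} - {b}. f j))"
    using assms by (simp add: prod.remove[of _ a] prod.remove[of _ b])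
  also have "(\<Prod>j\<in>{..<N} - {a} - {b}. f j) = (\<Prod>j\<in>{..<N} - {a} - {b}. c)"
    using assms by (intro prod.cong) auto
  also have "\<dots> = c ^ (N - 2)"
    using assms by (simp add: numeral_2_eq_2)
  finally show ?thesis by (simp add: mult_ac)
qed

text \<open>A party contributes a nonzero factor only if its bits pair up as input with output
  (weight \<open>p\<close>) or as ket with bra (weight \<open>q\<close>). So
  \<open>q\<^sup>2\<close> arises when a population moves from \<open>v\<close> to \<open>x\<close>,
  and \<open>p\<^sup>2\<close> when a coherence between \<open>x\<close> and \<open>y\<close> is
  preserved.\<close>

lemma prod_redistribution_single:
  fixes R :: real
  assumes "x < N" "y < N" "v < N" "z < N"
  defines "p \<equiv> coherent_coeff R" and "q \<equiv> mixing_coeff R"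
  shows "(\<Prod>j<N. redistribution R (j = x) (j = v) (j = z) (j = y)) =
    (if x = y then if v = z then if v = x then (p + q) ^ N else q\<^sup>2 * (p + q) ^ (N - 2) else 0
     else if v = x then if z = y then p\<^sup>2 * (p + q) ^ (N - 2) else 0 else 0)"
proof -
  let ?f = "\<lambda>j. redistribution R (j = x) (j = v) (j = z) (j = y)"
  \<comment> \<open>In the vanishing cases one party whose bits do not pair up kills the product:
    \<open>v\<close> in case 3, \<open>x\<close> in case 5, \<open>y\<close> in case 6.\<close>
  have zero: "(\<Prod>j<N. ?f j) = 0" if "j < N" "?f j = 0" for j
    using that by (intro prod_zero) auto
  consider "x = y" "v = z" "v = x" | "x = y" "v = z" "v \<noteq> x" | "x = y" "v \<noteq> z"
    | "x \<noteq> y" "v = x" "z = y" | "x \<noteq> y" "v \<noteq> x" | "x \<noteq> y" "v = x" "z \<noteq> y"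
    by blast
  then show ?thesis
  proof cases
    case 1
    then show ?thesis by (simp add: redistribution_eq p_def q_def)
  next
    case 2
    then have "(\<Prod>j<N. ?f j) = ?f x * ?f v * (p + q) ^ (N - 2)"
      using assms(1-4) by (intro prod_two_exceptions) (auto simp: redistribution_eq p_def q_def)
    then show ?thesis using 2 by (simp add: redistribution_eq q_def power2_eq_square)
  next
    case 3
    then show ?thesis using zero[of v] assms(3) by (simp add: redistribution_eq)
  next
    case 4
    then have "(\<Prod>j<N. ?f j) = ?f x * ?f y * (p + q) ^ (N - 2)"
      using assms(1-4) by (intro prod_two_exceptions) (auto simp: redistribution_eq p_def q_def)
    then show ?thesis using 4 by (simp add: redistribution_eq p_def power2_eq_square)
  next
    case 5
    then show ?thesis using zero[of x] assms(1) by (simp add: redistribution_eq)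
  next
    case 6
    then show ?thesis using zero[of y] assms(2) by (simp add: redistribution_eq)
  qed
qed

lemma sum_if_eq_const:
  fixes x N :: nat and a b :: "'b :: comm_ring_1"
  assumes "x < N"
  shows "(\<Sum>v<N. if v = x then a else b) = a + of_nat (N - 1) * b"
proof -
  have "(\<Sum>v<N. if v = x then a else b) = a + (\<Sum>v\<in>{..<N} - {x}. if v = x then a else b)"
    using assms by (simp add: sum.remove[of _ x])
  also have "(\<Sum>v\<in>{..<N} - {x}. if v = x then a else b) = (\<Sum>v\<in>{..<N} - {x}. b)"
    by (intro sum.cong) auto
  finally show ?thesis using assms by simp
qed

lemma sum_single_excitations:
  "(\<Sum>X\<in>single_excitations N. f X) = (\<Sum>x<N. f {Sys x})"
  unfolding single_excitations_def by (subst sum.reindex) (auto simp: inj_on_def)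

text \<open>The four amplitudes give \<open>1 / N\<^sup>2\<close>, and the free choice of
  \<open>x\<close> restores one factor \<open>N\<close>. For \<open>N = 1\<close> the truncated
  exponent \<open>N - 2\<close> is harmless because its term is multiplied by
  \<open>N - 1\<close>.\<close>

lemma numerator_t_W:
  fixes R :: real
  assumes "N \<ge> 1"
  defines "p \<equiv> coherent_coeff R" and "q \<equiv> mixing_coeff R"
  shows "numerator_t (single_excitations N) N R (W_state N) = complex_of_real
    (((p + q) ^ N + real (N - 1) * ((p\<^sup>2 + q\<^sup>2) * (p + q) ^ (N - 2))) / (real N * 3 ^ N))"
proof -
  define S where "S = (p + q) ^ N"
  define P where "P = p\<^sup>2 * (p + q) ^ (N - 2)"
  define Q where "Q = q\<^sup>2 * (p + q) ^ (N - 2)"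
  define c where "c = 1 / sqrt (real N)"
  have W: "W_state N {Sys x} = complex_of_real c" if "x < N" for x
    using that by (simp add: W_state_def single_excitations_def c_def)
  have c: "c * c * c * c = 1 / (real N)\<^sup>2"
    by (simp add: c_def field_simps power2_eq_square)
  have "numerator_t (single_excitations N) N R (W_state N) = complex_of_real (1 / 3 ^ N *
      (\<Sum>x<N. \<Sum>y<N. \<Sum>v<N. \<Sum>z<N. 1 / (real N)\<^sup>2 *
        (\<Prod>j<N. redistribution R (j = x) (j = v) (j = z) (j = y))))"
    unfolding numerator_t_def sum_single_excitations c[symmetric]
    by (simp add: W)
  also have "(\<Sum>x<N. \<Sum>y<N. \<Sum>v<N. \<Sum>z<N. 1 / (real N)\<^sup>2 *
        (\<Prod>j<N. redistribution R (j = x) (j = v) (j = z) (j = y))) = 1 / (real N)\<^sup>2 *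
      (\<Sum>x<N. \<Sum>y<N. \<Sum>v<N. \<Sum>z<N.
        if x = y then if v = z then if v = x then S else Q else 0
        else if v = x then if z = y then P else 0 else 0)"
    unfolding sum_distrib_left
    by (intro sum.cong refl arg_cong2[where f = "(*)"])
      (simp add: prod_redistribution_single p_def q_def S_def P_def Q_def)
  also have "(\<Sum>x<N. \<Sum>y<N. \<Sum>v<N. \<Sum>z<N.
        if x = y then if v = z then if v = x then S else Q else 0
        else if v = x then if z = y then P else 0 else 0) =
      (\<Sum>x<N. \<Sum>y<N. if y = x then S + real (N - 1) * Q else P)"
  proof (intro sum.cong refl)
    fix x y assume xy: "x \<in> {..<N}" "y \<in> {..<N}"
    show "(\<Sum>v<N. \<Sum>z<N. if x = y then if v = z then if v = x then S else Q else 0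
        else if v = x then if z = y then P else 0 else 0) =
        (if y = x then S + real (N - 1) * Q else P)"
    proof (cases "x = y")
      case True
      then have "(\<Sum>v<N. \<Sum>z<N. if x = y then if v = z then if v = x then S else Q else 0
          else if v = x then if z = y then P else 0 else 0) = (\<Sum>v<N. if v = x then S else Q)"
        by (intro sum.cong refl) simp
      then show ?thesis using True xy by (simp add: sum_if_eq_const)
    next
      case False
      then have "(\<Sum>v<N. \<Sum>z<N. if x = y then if v = z then if v = x then S else Q else 0
          else if v = x then if z = y then P else 0 else 0) = (\<Sum>v<N. if v = x then P else 0)"
        using xy by (intro sum.cong refl) simp
      then show ?thesis using False xy by simp
    qed
  qed
  also have "\<dots> = real N * (S + real (N - 1) * Q + real (N - 1) * P)"
    using assms(1) by (simp add: sum_if_eq_const of_nat_diff)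
  also have "1 / 3 ^ N * (1 / (real N)\<^sup>2 * (real N * (S + real (N - 1) * Q + real (N - 1) * P))) =
      (S + real (N - 1) * (P + Q)) / (real N * 3 ^ N)"
  proof -
    \<comment> \<open>Replacing \<open>real N\<close> and \<open>real (N - 1)\<close> by independent
      reals makes this pure field arithmetic.\<close>
    have "1 / 3 ^ N * (1 / n\<^sup>2 * (n * (S + m * Q + m * P))) = (S + m * (P + Q)) / (n * 3 ^ N)"
      for m n :: real
      by (simp add: power2_eq_square algebra_simps add_divide_distrib)
    then show ?thesis .
  qed
  also have "P + Q = (p\<^sup>2 + q\<^sup>2) * (p + q) ^ (N - 2)"
    by (simp add: P_def Q_def distrib_right)
  finally show ?thesis by (simp only: S_def)
qed

lemma W_state_unit:
  assumes "N \<ge> 1"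
  shows "braket (sys N) (W_state N) (W_state N) = 1"
proof -
  have "braket (sys N) (W_state N) (W_state N) =
      (\<Sum>X\<in>single_excitations N. cnj (W_state N X) * W_state N X)"
    unfolding braket_def
    by (intro sum.mono_neutral_right) (auto simp: W_state_def single_excitations_def sys_def)
  also have "\<dots> = (\<Sum>x<N. complex_of_real (1 / real N))"
    unfolding sum_single_excitations
    by (intro sum.cong refl) (simp add: W_state_def single_excitations_def flip: of_real_mult)
  finally show ?thesis using assms by simp
qed

lemma fidelity_t_W:
  assumes "N \<ge> 1"
  shows "complex_of_real (fidelity_t N R (W_state N)) =
    numerator_t (single_excitations N) N R (W_state N) / complex_of_real ((R\<^sup>2 - R + 1 / 3) ^ N)"
  using W_state_unit[OF assms]
  by (intro fidelity_t_eq) (auto simp: W_state_def single_excitations_def sys_def)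

section \<open>GHZ states\<close>

lemma sys_eq_empty_iff [simp]: "sys N = {} \<longleftrightarrow> N = 0"
  by (auto simp: sys_def lessThan_empty_iff)

lemma GHZ_state_unit:
  assumes "N \<ge> 1" "\<bar>\<alpha>\<bar> \<le> 1"
  shows "braket (sys N) (GHZ_state \<alpha> N) (GHZ_state \<alpha> N) = 1"
proof -
  have le: "\<alpha>\<^sup>2 \<le> 1" using assms by (simp add: abs_square_le_1)
  \<comment> \<open>For \<open>N = 0\<close> the two basis states would coincide and their
    amplitudes would add up.\<close>
  have ne: "{} \<noteq> sys N" using assms(1) by (metis not_one_le_zero sys_eq_empty_iff)
  define \<beta> where "\<beta> = sqrt (1 - \<alpha>\<^sup>2)"
  have "braket (sys N) (GHZ_state \<alpha> N) (GHZ_state \<alpha> N) =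
      (\<Sum>X\<in>{{}, sys N}. cnj (GHZ_state \<alpha> N X) * GHZ_state \<alpha> N X)"
    unfolding braket_def
    by (intro sum.mono_neutral_right) (auto simp: GHZ_state_def)
  also have "\<dots> = complex_of_real (\<alpha> * \<alpha> + \<beta> * \<beta>)"
    using ne assms(1) by (simp add: GHZ_state_def flip: \<beta>_def)
  also have "\<alpha> * \<alpha> + \<beta> * \<beta> = 1"
    using le by (simp add: \<beta>_def flip: power2_eq_square)
  finally show ?thesis by simp
qed

lemma fidelity_t_GHZ:
  assumes "N \<ge> 1" "\<bar>\<alpha>\<bar> \<le> 1"
  shows "complex_of_real (fidelity_t N R (GHZ_state \<alpha> N)) =
    numerator_t {{}, sys N} N R (GHZ_state \<alpha> N) / complex_of_real ((R\<^sup>2 - R + 1 / 3) ^ N)"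
  using GHZ_state_unit[OF assms] by (intro fidelity_t_eq) (auto simp: GHZ_state_def)

text \<open>On the two GHZ basis states all parties see the same four bits, so each product is the
  \<open>N\<close>-th power of one coefficient.\<close>

lemma numerator_t_GHZ:
  fixes R :: real
  assumes "N \<ge> 1" "\<bar>\<alpha>\<bar> \<le> 1"
  defines "p \<equiv> coherent_coeff R" and "q \<equiv> mixing_coeff R"
  shows "numerator_t {{}, sys N} N R (GHZ_state \<alpha> N) = complex_of_real
    (((\<alpha> ^ 4 + (1 - \<alpha>\<^sup>2)\<^sup>2) * (p + q) ^ N + 2 * \<alpha>\<^sup>2 * (1 - \<alpha>\<^sup>2) * (p ^ N + q ^ N)) / 3 ^ N)"
proof -
  define \<beta> where "\<beta> = sqrt (1 - \<alpha>\<^sup>2)"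
  have le: "\<alpha>\<^sup>2 \<le> 1" using assms by (simp add: abs_square_le_1)
  then have \<beta>: "1 - \<alpha>\<^sup>2 = \<beta>\<^sup>2" by (simp add: \<beta>_def)
  have ne: "{} \<noteq> sys N" using assms(1) by (metis not_one_le_zero sys_eq_empty_iff)
  have prod_sys: "(\<Prod>j<N. redistribution R (Sys j \<in> X) (Sys j \<in> V) (Sys j \<in> Z) (Sys j \<in> Y)) =
      redistribution R (X = sys N) (V = sys N) (Z = sys N) (Y = sys N) ^ N"
    if "X \<in> {{}, sys N}" "Y \<in> {{}, sys N}" "V \<in> {{}, sys N}" "Z \<in> {{}, sys N}" for X Y V Z
  proof -
    have "(Sys j \<in> X) = (X = sys N)" if "X \<in> {{}, sys N}" "j < N" for X j
      using that ne by (auto simp: sys_def)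
    then have "(\<Prod>j<N. redistribution R (Sys j \<in> X) (Sys j \<in> V) (Sys j \<in> Z) (Sys j \<in> Y)) =
      (\<Prod>j<N. redistribution R (X = sys N) (V = sys N) (Z = sys N) (Y = sys N))"
      using that by (intro prod.cong refl) auto
    then show ?thesis by simp
  qed
  have "numerator_t {{}, sys N} N R (GHZ_state \<alpha> N) = 1 / 3 ^ N *
     (\<Sum>X\<in>{{}, sys N}. \<Sum>Y\<in>{{}, sys N}. \<Sum>V\<in>{{}, sys N}. \<Sum>Z\<in>{{}, sys N}.
        cnj (GHZ_state \<alpha> N X) * GHZ_state \<alpha> N Y * GHZ_state \<alpha> N V * cnj (GHZ_state \<alpha> N Z) *
        complex_of_real (redistribution R (X = sys N) (V = sys N) (Z = sys N) (Y = sys N) ^ N))"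
    unfolding numerator_t_def
    by (intro arg_cong2[where f = "(*)"] refl sum.cong arg_cong[where f = complex_of_real] prod_sys)
  also have "\<dots> = complex_of_real
    (((\<alpha> ^ 4 + \<beta> ^ 4) * (p + q) ^ N + 2 * \<alpha>\<^sup>2 * \<beta>\<^sup>2 * (p ^ N + q ^ N)) / 3 ^ N)"
    \<comment> \<open>Of the sixteen index quadruples, two give \<open>p + q\<close>, two give
      \<open>p\<close> and two give \<open>q\<close>; the other ten contribute \<open>0 ^ N\<close>,
      which vanishes because \<open>N \<ge> 1\<close>.\<close>
    using ne assms(1)
    by (simp add: GHZ_state_def redistribution_eq p_def q_def zero_power flip: \<beta>_def)
      (simp add: field_simps power2_eq_square power4_eq_xxxx)
  finally show ?thesis by (simp add: \<beta> flip: power_mult)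
qed

section \<open>Degradation factors\<close>

text \<open>A convergent prefactor may be replaced by its limit; positivity of the limit makes it
  admissible as the constant in \<open>decays_like\<close>.\<close>

lemma decays_likeI:
  assumes "\<And>N. N \<ge> M \<Longrightarrow> F N = g N * c ^ N" and "g \<longlonglongrightarrow> K" and "K > 0" "c > 0"
  shows "decays_like F c"
proof -
  have "(\<lambda>N. g N / K) \<longlonglongrightarrow> K / K"
    using assms by (intro tendsto_intros) auto
  then have "(\<lambda>N. g N / K) \<longlonglongrightarrow> 1"
    using assms by simp
  moreover have "\<forall>\<^sub>F N in sequentially. g N / K = F N / (K * c ^ N)"
    using eventually_ge_at_top[of M] by eventually_elim (use assms in simp)
  ultimately have "(\<lambda>N. F N / (K * c ^ N)) \<longlonglongrightarrow> 1"
    by (simp add: tendsto_cong)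
  then have "F \<sim>[at_top] (\<lambda>N. K * c ^ N)"
    by (rule asymp_equivI')
  then show ?thesis using assms by (auto simp: decays_like_def)
qed

lemma degradation_factor_eqI: "decays_like F c \<Longrightarrow> degradation_factor F = c"
  unfolding degradation_factor_def by (blast intro: the_equality decays_like_unique)

text \<open>The fidelity of a single basis state under the normalised one-party map,
  \<open>(p + q) / (p + 2 q)\<close>.\<close>

definition party_fidelity :: "real \<Rightarrow> real" where
  "party_fidelity R = (coherent_coeff R + mixing_coeff R) / (3 * (R\<^sup>2 - R + 1 / 3))"

context
  fixes R :: real
  assumes R: "R \<in> {0..1 / 2}"
begin

text \<open>The bound \<open>R \<le> 1 / 2\<close> enters here: \<open>p\<close> is negative for
  \<open>R\<close> strictly between \<open>1 / 2\<close> and 1.\<close>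

lemma coherent_coeff_nonneg: "coherent_coeff R \<ge> 0"
  using R by (simp add: coherent_coeff_def)

lemma mixing_coeff_nonneg: "mixing_coeff R \<ge> 0"
  by (simp add: mixing_coeff_def)

lemma coeff_sum_pos: "coherent_coeff R + mixing_coeff R > 0"
proof (cases "R = 0")
  case True
  then show ?thesis by (simp add: coherent_coeff_def mixing_coeff_def)
next
  case False
  then have "mixing_coeff R > 0" by (simp add: mixing_coeff_def)
  then show ?thesis using coherent_coeff_nonneg by linarith
qed

lemma party_trace_pos: "R\<^sup>2 - R + 1 / 3 > 0"
proof -
  have "R\<^sup>2 - R + 1 / 3 = (R - 1 / 2)\<^sup>2 + 1 / 12" by (simp add: power2_eq_square algebra_simps)
  then show ?thesis using zero_le_power2[of "R - 1 / 2"] by linarith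
qed

lemma party_fidelity_pos: "party_fidelity R > 0"
  using coeff_sum_pos party_trace_pos by (simp add: party_fidelity_def)

lemma party_fidelity_power:
  "(coherent_coeff R + mixing_coeff R) ^ N / 3 ^ N / (R\<^sup>2 - R + 1 / 3) ^ N = party_fidelity R ^ N"
  unfolding party_fidelity_def power_divide power_mult_distrib by simp

lemma decays_like_W: "decays_like (\<lambda>N. fidelity_t N R (W_state N)) (party_fidelity R)"
proof -
  define p where "p = coherent_coeff R"
  define q where "q = mixing_coeff R"
  \<comment> \<open>\<open>K\<close> is the weight of the terms with two distinct excitations
    relative to \<open>(p + q) ^ N\<close>. The all-equal terms have share \<open>1 / N\<close>, so
    \<open>g\<close> tends to \<open>K\<close>.\<close>
  define K where "K = (p\<^sup>2 + q\<^sup>2) / (p + q)\<^sup>2"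
  define g where "g N = 1 / real N + (1 - 1 / real N) * K" for N :: nat
  have pq: "p + q > 0" using coeff_sum_pos by (simp add: p_def q_def)
  then have "p \<noteq> 0 \<or> q \<noteq> 0" by auto
  then have K: "K > 0" using pq by (simp add: K_def sum_power2_gt_zero_iff)
  show ?thesis
  proof (rule decays_likeI)
    fix N :: nat assume N: "N \<ge> 2"
    have "(p + q) ^ N = (p + q)\<^sup>2 * (p + q) ^ (N - 2)"
      by (simp only: le_add_diff_inverse[OF N] flip: power_add)
    then have eq: "(p\<^sup>2 + q\<^sup>2) * (p + q) ^ (N - 2) = K * (p + q) ^ N"
      using pq by (simp add: K_def)
    have "fidelity_t N R (W_state N) = ((p + q) ^ N + real (N - 1) * (K * (p + q) ^ N)) /
        (real N * 3 ^ N) / (R\<^sup>2 - R + 1 / 3) ^ N"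
      using fidelity_t_W[of N R] N
      unfolding numerator_t_W[OF order.trans[OF one_le_numeral N], of R, folded p_def q_def] eq
        of_real_divide[symmetric] of_real_eq_iff by simp
    also have "(p + q) ^ N + real (N - 1) * (K * (p + q) ^ N) = real N * (g N * (p + q) ^ N)"
      using N by (simp add: g_def of_nat_diff field_simps)
    also have "real N * (g N * (p + q) ^ N) / (real N * 3 ^ N) = g N * ((p + q) ^ N / 3 ^ N)"
      using N by simp
    finally show "fidelity_t N R (W_state N) = g N * party_fidelity R ^ N"
      by (simp only: p_def q_def times_divide_eq_right[symmetric] party_fidelity_power)
  next
    have "(\<lambda>N. 1 / real N + (1 - 1 / real N) * K) \<longlonglongrightarrow> 0 + (1 - 0) * K"
      by (intro tendsto_intros lim_1_over_n)
    then show "g \<longlonglongrightarrow> K" by (simp add: g_def[abs_def])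
  qed (use K party_fidelity_pos in auto)
qed

lemma decays_like_GHZ:
  assumes "\<bar>\<alpha>\<bar> \<le> 1"
  shows "decays_like (\<lambda>N. fidelity_t N R (GHZ_state \<alpha> N)) (party_fidelity R)"
proof -
  define p where "p = coherent_coeff R"
  define q where "q = mixing_coeff R"
  define a where "a = \<alpha> ^ 4 + (1 - \<alpha>\<^sup>2)\<^sup>2"
  define b where "b = 2 * \<alpha>\<^sup>2 * (1 - \<alpha>\<^sup>2)"
  \<comment> \<open>\<open>l r\<close> is the limit of \<open>r ^ N\<close> for \<open>r\<close> in
    the closed unit interval.\<close>
  define l where "l r = (if r = 1 then 1 else 0 :: real)" for r :: real
  have pq: "p + q > 0" "p \<ge> 0" "q \<ge> 0"
    using coeff_sum_pos coherent_coeff_nonneg mixing_coeff_nonneg by (simp_all add: p_def q_def)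
  have "\<alpha>\<^sup>2 \<le> 1" using assms by (simp add: abs_square_le_1)
  then have b: "b \<ge> 0" by (simp add: b_def)
  \<comment> \<open>The two summands never vanish together: at \<open>\<alpha> = 0\<close> the
    second is 1, otherwise the first is positive.\<close>
  have a: "a > 0" by (cases "\<alpha> = 0") (auto simp: a_def intro!: add_pos_nonneg)
  have lim: "(\<lambda>N. r ^ N) \<longlonglongrightarrow> l r" if "0 \<le> r" "r \<le> 1" for r
    using that by (auto simp: l_def intro: LIMSEQ_realpow_zero)
  \<comment> \<open>At \<open>R = 0\<close> or \<open>R = 1 / 2\<close> one of the two ratios is 1 and contributes to the prefactor.\<close>
  have l: "l r \<ge> 0" for r by (simp add: l_def)
  show ?thesis
  proof (rule decays_likeI)
    fix N :: nat assume N: "N \<ge> 1"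
    have "fidelity_t N R (GHZ_state \<alpha> N) =
        (a * (p + q) ^ N + b * (p ^ N + q ^ N)) / 3 ^ N / (R\<^sup>2 - R + 1 / 3) ^ N"
      using fidelity_t_GHZ[OF N assms, of R]
      unfolding numerator_t_GHZ[OF N assms, folded a_def b_def, of R, folded p_def q_def]
        of_real_divide[symmetric] of_real_eq_iff .
    also have "a * (p + q) ^ N + b * (p ^ N + q ^ N) =
        (a + b * ((p / (p + q)) ^ N + (q / (p + q)) ^ N)) * (p + q) ^ N"
      using pq by (simp add: power_divide field_simps)
    finally show "fidelity_t N R (GHZ_state \<alpha> N) =
        (a + b * ((p / (p + q)) ^ N + (q / (p + q)) ^ N)) * party_fidelity R ^ N"
      by (simp only: p_def q_def times_divide_eq_right[symmetric] party_fidelity_power)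
  next
    show "(\<lambda>N. a + b * ((p / (p + q)) ^ N + (q / (p + q)) ^ N)) \<longlonglongrightarrow>
        a + b * (l (p / (p + q)) + l (q / (p + q)))"
      using pq by (intro tendsto_intros lim) auto
    show "a + b * (l (p / (p + q)) + l (q / (p + q))) > 0"
      using a b l by (simp add: add_pos_nonneg)
  qed (rule party_fidelity_pos)
qed

end

theorem theorem2:
  fixes \<alpha> :: real
  assumes "\<bar>\<alpha>\<bar> \<le> 1"
  shows
    "(\<forall>R\<in>{0..1}. \<forall>N\<ge>1.
        complex_of_real (fidelity_t N R (W_state N)) =
          numerator_t (single_excitations N) N R (W_state N)
            / complex_of_real ((R\<^sup>2 - R + 1 / 3) ^ N) \<and>
        complex_of_real (fidelity_t N R (GHZ_state \<alpha> N)) =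
          numerator_t {{}, sys N} N R (GHZ_state \<alpha> N)
            / complex_of_real ((R\<^sup>2 - R + 1 / 3) ^ N)) \<and>
     (\<forall>R\<in>{0..1 / 2}.
        decays_like (\<lambda>N. fidelity_t N R (W_state N)) (c_W R) \<and>
        decays_like (\<lambda>N. fidelity_t N R (GHZ_state \<alpha> N)) (c_GHZ \<alpha> R) \<and>
        c_W R \<ge> c_GHZ \<alpha> R)"
proof -
  have "decays_like (\<lambda>N. fidelity_t N R (W_state N)) (c_W R) \<and>
      decays_like (\<lambda>N. fidelity_t N R (GHZ_state \<alpha> N)) (c_GHZ \<alpha> R) \<and> c_W R \<ge> c_GHZ \<alpha> R"
    if "R \<in> {0..1 / 2}" for R
    \<comment> \<open>Uniqueness of the decay factor evaluates both definite descriptions to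
      \<open>party_fidelity R\<close>, so the comparison holds with equality.\<close>
    using decays_like_W[OF that] decays_like_GHZ[OF that assms]
    by (simp add: c_W_def c_GHZ_def degradation_factor_eqI)
  then show ?thesis
    using fidelity_t_W fidelity_t_GHZ[OF _ assms] by blast
qed

end
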